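(* If $N\geq 2$, then for any $N$-dimensional vector subspace $\mathcal{F}^N\subset C^0(\mathbb{R}^1,\mathbb{R}^1)$ there exist independent $n$-chord diagrams $\{(a_1,b_1),\dots,(a_n,b_n)\}$ with arbitrarily large $n$ such that the corresponding systems of equality conditions $f(a_i)=f(b_i)$, $i=1,\dots,n$, have non-trivial solutions $f\in\mathcal{F}^N$.
   Context: $C^0(\mathbb{R}^1,\mathbb{R}^1)$ is the space of continuous functions $\mathbb{R}^1\to\mathbb{R}^1$. A chord is an unordered pair $(a,b)$ of distinct points of $\mathbb{R}^1$; an $n$-chord diagram is an unordered collection of $n$ pairwise distinct chords $\{(a_1,b_1),\dots,(a_n,b_n)\}$. It is independent if the subalgebra of $C^0(\mathbb{R}^1,\mathbb{R}^1)$ consisting of all functions satisfying $f(a_i)=f(b_i)$, $i=1,\dots,n$, has codimension exactly $n$. A non-trivial solution is a solution that is not the zero function. *)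

theory Defs
  imports "HOL-Analysis.Analysis" "HOL-Library.Function_Algebras"
begin

(* Pointwise real vector space structure on functions, so that the notions
   subspace, span, dim of the library apply to sets of functions. Note that dim is 0 on infinite-dimensional spaces, so
   dim F = N with N > 0 includes finite dimensionality. *)

instantiation "fun" :: (type, real_vector) real_vector
begin

definition scaleR_fun_def: "r *\<^sub>R f = (\<lambda>x. r *\<^sub>R f x)"

instance
  by standard (auto simp: scaleR_fun_def fun_eq_iff algebra_simps)

end

definition C0 :: "(real \<Rightarrow> real) set" where
  "C0 = {f. continuous_on UNIV f}"

(* The quotient space V/A has dimension n: there are n elements of V whose classes
   modulo A are linearly independent and span V/A. Independence also makes these
   classes pairwise distinct. Intended for subspaces A \<subseteq> V. *)

definition has_codimension_in :: "'a::real_vector set \<Rightarrow> 'a set \<Rightarrow> nat \<Rightarrow> bool" where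
  "has_codimension_in A V n \<longleftrightarrow>
     (\<exists>B. B \<subseteq> V \<and> finite B \<and> card B = n \<and>
        (\<forall>c. (\<Sum>b\<in>B. c b *\<^sub>R b) \<in> A \<longrightarrow> (\<forall>b\<in>B. c b = 0)) \<and>
        (\<forall>v\<in>V. \<exists>c. v - (\<Sum>b\<in>B. c b *\<^sub>R b) \<in> A))"

(* A chord is an unordered pair of distinct points, i.e. a two-element set. *)

definition is_chord :: "real set \<Rightarrow> bool" where
  "is_chord e \<longleftrightarrow> (\<exists>a b. a \<noteq> b \<and> e = {a, b})"

definition is_chord_diagram :: "nat \<Rightarrow> real set set \<Rightarrow> bool" where
  "is_chord_diagram n D \<longleftrightarrow> finite D \<and> card D = n \<and> (\<forall>e\<in>D. is_chord e)"

definition satisfies_equalities :: "real set set \<Rightarrow> (real \<Rightarrow> real) \<Rightarrow> bool" where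
  "satisfies_equalities D f \<longleftrightarrow> (\<forall>a b. {a, b} \<in> D \<longrightarrow> f a = f b)"

definition equality_subalgebra :: "real set set \<Rightarrow> (real \<Rightarrow> real) set" where
  "equality_subalgebra D = {f \<in> C0. satisfies_equalities D f}"

definition independent_chord_diagram :: "nat \<Rightarrow> real set set \<Rightarrow> bool" where
  "independent_chord_diagram n D \<longleftrightarrow>
     is_chord_diagram n D \<and> has_codimension_in (equality_subalgebra D) C0 n"

lemma subspace_C0: "subspace C0"
  by (auto simp: subspace_def C0_def zero_fun_def plus_fun_def scaleR_fun_def
      intro!: continuous_intros)

lemma subspace_equality_subalgebra: "subspace (equality_subalgebra D)"
  using subspace_C0
  by (auto simp: subspace_def equality_subalgebra_def satisfies_equalities_def
      scaleR_fun_def)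

lemma one_in_equality_subalgebra: "1 \<in> equality_subalgebra D"
  by (auto simp: equality_subalgebra_def satisfies_equalities_def C0_def one_fun_def)

lemma times_in_equality_subalgebra:
  "f \<in> equality_subalgebra D \<Longrightarrow> g \<in> equality_subalgebra D \<Longrightarrow> f * g \<in> equality_subalgebra D"
  by (auto simp: equality_subalgebra_def satisfies_equalities_def C0_def times_fun_def
      intro!: continuous_intros)

end

theory Submission
  imports Defs
begin

text \<open>A linear functional such as \<open>f \<mapsto> f 0 - f 1\<close> has a non-trivial zero \<open>f\<close> on any space of
  dimension at least 2. By the intermediate value theorem a single coincidence \<open>f 0 = f 1\<close> of a
  continuous function forces infinitely many further ones on pairwise disjoint chords, and
  Lagrange interpolation at the endpoints shows that disjoint chords are independent.\<close>

text \<open>The functional \<open>h \<mapsto> h x - h y\<close> vanishes at \<open>g\<close> or,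
  failing that, at \<open>f\<close> minus a suitable multiple of \<open>g\<close>, where
  \<open>f\<close> and \<open>g\<close> are two independent elements; independence keeps both
  candidates nonzero.\<close>

lemma exists_nonzero_with_equal_values:
  fixes F :: "(real \<Rightarrow> real) set"
  assumes F: "subspace F" and dim: "dim F \<ge> 2"
  shows "\<exists>f\<in>F. f \<noteq> 0 \<and> f x = f y"
proof -
  obtain B where B: "B \<subseteq> F" "independent B" "card B = dim F"
    using basis_exists by metis
  \<comment> \<open>An infinite \<open>B\<close> would have \<open>card B = 0\<close>, contradicting
    \<open>dim F \<ge> 2\<close>.\<close>
  then have "finite B" "\<not> card B \<le> Suc 0"
    using dim card.infinite by force+
  then obtain f g where fg: "f \<in> B" "g \<in> B" "f \<noteq> g"
    using card_le_Suc0_iff_eq by blast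
  have ind: "independent {f, g}"
    using B(2) fg by (intro independent_mono[OF B(2)]) auto
  have in_F: "f \<in> F" "g \<in> F"
    using fg B(1) by auto
  show ?thesis
  proof (cases "g x = g y")
    case True
    moreover have "g \<noteq> 0"
      using ind dependent_zero by blast
    ultimately show ?thesis
      using in_F by blast
  next
    case False
    define h where "h = f - ((f x - f y) / (g x - g y)) *\<^sub>R g"
    have "h \<in> F"
      unfolding h_def using F in_F by (intro subspace_diff subspace_scale)
    moreover have "h x = h y"
      using False by (simp add: h_def scaleR_fun_def field_simps)
    moreover have "h \<noteq> 0"
    proof
      assume "h = 0"
      then have "f = ((f x - f y) / (g x - g y)) *\<^sub>R g"
        by (simp add: h_def)
      then have "f \<in> span {g}"
        by (metis span_base span_scale singletonI)
      then show False
        using ind fg(3) by (simp add: independent_insert)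
    qed
    ultimately show ?thesis
      by blast
  qed
qed

text \<open>Segments treat rising and falling \<open>f\<close> alike, and excluding their ends keeps
  \<open>c\<close> away from \<open>a\<close> and \<open>b\<close>.\<close>

lemma IVT_open_segment:
  fixes f :: "real \<Rightarrow> real"
  assumes cont: "continuous_on UNIV f" and "a < b" and v: "v \<in> open_segment (f a) (f b)"
  obtains c where "a < c" "c < b" "f c = v"
proof -
  have "connected (f ` {a..b})"
    by (intro connected_continuous_image continuous_on_subset[OF cont]) auto
  then have "closed_segment (f a) (f b) \<subseteq> f ` {a..b}"
    using \<open>a < b\<close> by (intro closed_segment_subset) (auto simp flip: connected_convex_1)
  then obtain c where c: "c \<in> {a..b}" "f c = v"
    using v by (auto simp: open_segment_def)
  moreover have "c \<noteq> a" "c \<noteq> b"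
    using v c by (auto simp: open_segment_def)
  ultimately show thesis
    using that by force
qed

text \<open>If \<open>f\<close> takes a value other than \<open>f x\<close> at some \<open>m\<close>
  inside the interval, it attains everything strictly between \<open>f x\<close> and
  \<open>f m\<close> on both sides of \<open>m\<close>. Otherwise \<open>f\<close> is constant
  inside, and any inner points serve.\<close>

lemma infinitely_many_coincidences:
  fixes f :: "real \<Rightarrow> real"
  assumes cont: "continuous_on UNIV f" and "x < y" and eq: "f x = f y"
  obtains a b :: "nat \<Rightarrow> real" where
    "inj a" "inj b" "\<And>i j. a i < b j" "\<And>i. f (a i) = f (b i)"
proof (cases "\<exists>m. x < m \<and> m < y \<and> f m \<noteq> f x")
  case True
  then obtain m where m: "x < m" "m < y" "f m \<noteq> f x"
    by blast
  \<comment> \<open>Infinitely many distinct levels; the denominators start at 2, so each lies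
    strictly between \<open>f x\<close> and \<open>f m\<close>.\<close>
  define v where "v i = f x + (f m - f x) / (real i + 2)" for i
  have inj_v: "inj v"
    using m by (auto simp: inj_def v_def)
  have v: "v i \<in> open_segment (f x) (f m)" for i
    using m by (auto simp: in_segment v_def algebra_simps intro!: exI[of _ "1 / (real i + 2)"])
       (auto simp: divide_simps)
  have "\<exists>c. x < c \<and> c < m \<and> f c = v i" for i
    by (rule IVT_open_segment[OF cont m(1) v[of i]]) auto
  then obtain a where a: "\<And>i. a i < m" "\<And>i. f (a i) = v i"
    by metis
  have "v i \<in> open_segment (f m) (f y)" for i
    using v[of i] eq by (simp add: open_segment_commute)
  then have "\<exists>c. m < c \<and> c < y \<and> f c = v i" for i
    by (rule IVT_open_segment[OF cont m(2), of "v i"]) auto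
  then obtain b where b: "\<And>i. m < b i" "\<And>i. f (b i) = v i"
    by metis
  show thesis
  proof (rule that)
    show "inj a" "inj b"
      using a(2) b(2) inj_v by (metis injD injI)+
    show "a i < b j" for i j
      using a(1)[of i] b(1)[of j] by simp
    show "f (a i) = f (b i)" for i
      using a(2) b(2) by simp
  qed
next
  case False
  \<comment> \<open>Denominators from 3 on keep each offset below half the length, so every
    \<open>a i\<close> lies left of the midpoint and every \<open>b j\<close> right of it.\<close>
  define a where "a i = x + (y - x) / (real i + 3)" for i
  define b where "b i = y - (y - x) / (real i + 3)" for i
  have small: "0 < (y - x) / (real i + 3)" "(y - x) / (real i + 3) < (y - x) / 2" for i
    using \<open>x < y\<close> by (intro divide_pos_pos divide_strict_left_mono; simp)+
  show thesis
  proof (rule that)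
    show "inj a" "inj b"
      using \<open>x < y\<close> by (auto simp: inj_def a_def b_def)
    show "a i < b j" for i j
      using small(2)[of i] small(2)[of j] unfolding a_def b_def by argo
    have "x < a i" "a i < y" "x < b i" "b i < y" for i
      using small[of i] \<open>x < y\<close> unfolding a_def b_def by argo+
    then show "f (a i) = f (b i)" for i
      using False by metis
  qed
qed

lemma Lagrange_basis_exists:
  fixes S :: "real set"
  assumes "finite S"
  obtains L where "L \<in> C0" "L p = 1" "\<And>q. q \<in> S \<Longrightarrow> q \<noteq> p \<Longrightarrow> L q = 0"
proof
  define L where "L = (\<lambda>t. \<Prod>q\<in>S - {p}. (t - q) / (p - q))"
  show "L \<in> C0"
    by (auto simp: C0_def L_def intro!: continuous_intros)
  show "L p = 1"
    by (auto simp: L_def intro!: prod.neutral)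
  show "L q = 0" if "q \<in> S" "q \<noteq> p" for q
    using that assms by (auto simp: L_def)
qed

text \<open>Each \<open>a i\<close> is an endpoint of one chord only, so there are
  \<open>L i\<close> in \<open>C0\<close> equal to 1 at \<open>a i\<close> and 0 at all other
  endpoints. The jump of a combination of the \<open>L i\<close> across the chord
  \<open>{a j, b j}\<close> is then the coefficient of \<open>L j\<close>.\<close>

lemma independent_disjoint_chords:
  fixes a b :: "'i \<Rightarrow> real"
  assumes I: "finite I" and inj_a: "inj_on a I"
    and disj: "\<And>i j. i \<in> I \<Longrightarrow> j \<in> I \<Longrightarrow> a i \<noteq> b j"
  shows "independent_chord_diagram (card I) ((\<lambda>i. {a i, b i}) ` I)"
proof -
  let ?D = "(\<lambda>i. {a i, b i}) ` I"
  have "inj_on (\<lambda>i. {a i, b i}) I"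
    using inj_a disj by (auto simp: inj_on_def doubleton_eq_iff)
  then have "is_chord_diagram (card I) ?D"
    using I disj by (auto simp: is_chord_diagram_def is_chord_def card_image)
  moreover have "has_codimension_in (equality_subalgebra ?D) C0 (card I)"
  proof -
    have "\<exists>L. L \<in> C0 \<and> L (a i) = 1 \<and> (\<forall>q \<in> a ` I \<union> b ` I. q \<noteq> a i \<longrightarrow> L q = 0)" for i
      by (rule Lagrange_basis_exists[of "a ` I \<union> b ` I" "a i"]) (use I in auto)
    then obtain L where L: "\<And>i. L i \<in> C0" "\<And>i. L i (a i) = 1"
      and L0: "\<And>i q. q \<in> a ` I \<union> b ` I \<Longrightarrow> q \<noteq> a i \<Longrightarrow> L i q = 0"
      by metis
    have La: "L i (a j) = (if j = i then 1 else 0)" if "i \<in> I" "j \<in> I" for i j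
      using that L(2) L0[of "a j" i] inj_a by (auto simp: inj_on_def)
    have Lb: "L i (b j) = 0" if "i \<in> I" "j \<in> I" for i j
      using that L0[of "b j" i] disj[of i j] by auto
    \<comment> \<open>The codimension witness is a set of functions, so distinct indices have to
      give distinct \<open>L i\<close>.\<close>
    have inj_L: "inj_on L I"
      using La by (metis inj_onI zero_neq_one)
    have eval: "(\<Sum>u\<in>L ` I. c u *\<^sub>R u) t = (\<Sum>i\<in>I. c (L i) * L i t)" for c t
    proof -
      have "(\<Sum>u\<in>A. c u *\<^sub>R u) t = (\<Sum>u\<in>A. c u * u t)" if "finite A" for A
        using that by induction (auto simp: scaleR_fun_def)
      from this[of "L ` I"] I show ?thesis
        by (simp add: sum.reindex[OF inj_L])
    qed
    have comb_a: "(\<Sum>u\<in>L ` I. c u *\<^sub>R u) (a j) = c (L j)" if "j \<in> I" for c j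
      using that I by (simp add: eval La if_distrib cong: if_cong sum.cong)
    have comb_b: "(\<Sum>u\<in>L ` I. c u *\<^sub>R u) (b j) = 0" if "j \<in> I" for c j
      using that by (simp add: eval Lb)
    have mem: "g \<in> equality_subalgebra ?D \<longleftrightarrow> g \<in> C0 \<and> (\<forall>i\<in>I. g (a i) = g (b i))" for g
      by (auto simp: equality_subalgebra_def satisfies_equalities_def doubleton_eq_iff)
    show ?thesis
      unfolding has_codimension_in_def
    proof (intro exI[of _ "L ` I"] conjI allI impI ballI)
      show "L ` I \<subseteq> C0" "finite (L ` I)" "card (L ` I) = card I"
        using L(1) I inj_L by (auto simp: card_image)
    next
      fix c u
      assume "(\<Sum>u\<in>L ` I. c u *\<^sub>R u) \<in> equality_subalgebra ?D" "u \<in> L ` I"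
      \<comment> \<open>For \<open>u = L j\<close>, membership equates the values at
        \<open>a j\<close> and \<open>b j\<close>, which are \<open>c u\<close> and 0.\<close>
      then show "c u = 0"
        using comb_a[of _ c] comb_b[of _ c] unfolding mem by force
    next
      fix g assume g: "g \<in> C0"
      \<comment> \<open>The coefficient of \<open>L i\<close> is the jump of \<open>g\<close> across
        chord \<open>i\<close>, so subtracting the combination removes all jumps;
        \<open>inv_into\<close> recovers \<open>i\<close> from the function
        \<open>L i\<close>.\<close>
      define c where "c u = (let i = inv_into I L u in g (a i) - g (b i))" for u
      have c: "c (L i) = g (a i) - g (b i)" if "i \<in> I" for i
        using that inj_L by (simp add: c_def)
      have "g - (\<Sum>u\<in>L ` I. c u *\<^sub>R u) \<in> C0"
        using L(1) g by (intro subspace_diff subspace_sum subspace_scale subspace_C0) auto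
      then have "g - (\<Sum>u\<in>L ` I. c u *\<^sub>R u) \<in> equality_subalgebra ?D"
        unfolding mem by (simp add: comb_a comb_b c)
      then show "\<exists>c. g - (\<Sum>u\<in>L ` I. c u *\<^sub>R u) \<in> equality_subalgebra ?D"
        by blast
    qed
  qed
  ultimately show ?thesis
    by (simp add: independent_chord_diagram_def)
qed

theorem corollary2:
  fixes N :: nat and F :: "(real \<Rightarrow> real) set"
  assumes "N \<ge> 2"
    and "subspace F" and "F \<subseteq> C0" and "dim F = N"
  shows "\<forall>m. \<exists>n\<ge>m. \<exists>D. independent_chord_diagram n D \<and>
           (\<exists>f\<in>F. f \<noteq> 0 \<and> satisfies_equalities D f)"
proof
  fix m :: nat
  obtain f where f: "f \<in> F" "f \<noteq> 0" "f 0 = f 1"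
    using exists_nonzero_with_equal_values[of F 0 1] assms by auto
  have "continuous_on UNIV f"
    using f(1) assms(3) by (auto simp: C0_def)
  then obtain a b :: "nat \<Rightarrow> real" where ab: "inj a" "inj b" "\<And>i j. a i < b j"
    "\<And>i. f (a i) = f (b i)"
    using infinitely_many_coincidences[of f 0 1] f(3) zero_less_one by blast
  \<comment> \<open>The first \<open>m\<close> coincidences already give a diagram with
    \<open>n = m\<close>.\<close>
  let ?D = "(\<lambda>i. {a i, b i}) ` {..<m}"
  have "independent_chord_diagram (card {..<m}) ?D"
    using ab by (intro independent_disjoint_chords) (auto intro: inj_on_subset simp: less_imp_neq)
  moreover have "satisfies_equalities ?D f"
    using ab(4) by (auto simp: satisfies_equalities_def doubleton_eq_iff)
  ultimately show "\<exists>n\<ge>m. \<exists>D. independent_chord_diagram n D \<and>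
      (\<exists>f\<in>F. f \<noteq> 0 \<and> satisfies_equalities D f)"
    using f by auto
qed

end
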